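(* Fix $d\ge3$, $c>0$, $\frac{d-1}{d+1}<\delta<1$, and integers $0\le m\le d-1$ and $l\ge m$. Let $p=(c+o_n(1))n^{-d+1+\delta}$, $\mathcal{H}$ the random $d$-uniform hypergraph on $[n]$ with each $d$-subset a hyperedge independently with probability $p$, and $\Psi=\mathrm{Proj}(\mathcal{H})$. Let $X$ be the set of $h\in\binom{[n]}{d}$ with $h\cap[l]=[m]$ and $\binom{h}{2}\setminus\binom{[m]}{2}\subseteq E(\Psi)$ (with $[0]=\emptyset$). Then \[ \mathbb{E}[|X|]=(1+o_n(1))\binom{n}{d-m}\left(\frac{c\,n^{\delta-1}}{(d-2)!}\right)^{\binom d2-\binom m2}. \]
   Context: $\mathrm{Proj}(H)$ is the graph on $[n]$ with $\{i,j\}$ an edge iff some hyperedge of $H$ contains $\{i,j\}$; $\binom{S}{2}$ denotes the set of 2-subsets of $S$. *)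

theory Defs
  imports "HOL-Probability.Probability" "HOL-Probability.Product_PMF"
    "HOL-Library.Ramsey" "HOL-Library.Landau_Symbols"
begin

text \<open>
  A \<open>d\<close>-uniform hypergraph on \<open>{1..n}\<close> is represented by its set of hyperedges, and a graph on
  \<open>{1..n}\<close> by its set of edges (2-element sets).  The set of \<open>k\<close>-subsets of \<open>S\<close> is \<open>nsets S k\<close>.
\<close>

definition random_hypergraph :: "nat \<Rightarrow> nat \<Rightarrow> real \<Rightarrow> nat set set pmf" where
  "random_hypergraph n d p =
     map_pmf (\<lambda>\<omega>. {h \<in> nsets {1..n} d. \<omega> h})
       (Pi_pmf (nsets {1..n} d) False (\<lambda>_. bernoulli_pmf p))"

definition proj_edges :: "nat \<Rightarrow> nat set set \<Rightarrow> nat set set" where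
  "proj_edges n H = {e \<in> nsets {1..n} 2. \<exists>h\<in>H. e \<subseteq> h}"

text \<open>
  The set \<open>X\<close> of the theorem as a function of the edge set \<open>E\<close> of a graph on \<open>{1..n}\<close>.
  Pairs inside \<open>{1..m}\<close> are not required to be edges; \<open>{1..0}\<close> is empty.
\<close>

definition rooted_cliques :: "nat \<Rightarrow> nat \<Rightarrow> nat \<Rightarrow> nat \<Rightarrow> nat set set \<Rightarrow> nat set set" where
  "rooted_cliques n d m l E =
     {h \<in> nsets {1..n} d. h \<inter> {1..l} = {1..m} \<and> nsets h 2 - nsets {1..m} 2 \<subseteq> E}"

end

theory Submission
  imports Defs "HOL-Real_Asymp.Real_Asymp"
begin

text \<open>
  Fix an admissible \<open>h\<close> and classify the hyperedges \<open>g\<close> by their trace \<open>g \<inter> h\<close>. Distinct traces involve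
  disjoint sets of potential hyperedges, so the events that given traces occur are independent.

  If each required pair is itself a trace, the pairs are covered; this gives the lower bound, of the
  claimed order. Otherwise some family \<open>F\<close> of traces covers the pairs and contains a trace with at
  least three elements. A trace of size \<open>s\<close> occurs with probability \<open>O(n\<^sup>1\<^sup>+\<^sup>\<delta>\<^sup>-\<^sup>s)\<close>, whereas
  covering its pairs by separate hyperedges costs \<open>a\<close> to the power \<open>s choose 2\<close> with
  \<open>a = n powr (\<delta> - 1)\<close>. The hypothesis on \<open>\<delta>\<close> says exactly that for \<open>3 \<le> s \<le> d\<close> the former is
  smaller by a fixed power of \<open>n\<close>, and the number of families \<open>F\<close> is bounded in terms of \<open>d\<close> alone.
\<close>

section \<open>Exact probability that prescribed traces occur\<close>

text \<open>Events that depend on disjoint blocks of independent coordinates are independent, and a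
  block \<open>B S\<close> contains no success with probability
  \<open>(1 - p) ^ card (B S)\<close>.\<close>

lemma prob_Pi_pmf_hits:
  fixes A :: "'a set" and B :: "'b \<Rightarrow> 'a set" and p :: real
  assumes "finite A" "finite F" "0 \<le> p" "p \<le> 1"
    and B: "\<And>S. S \<in> F \<Longrightarrow> B S \<subseteq> A" and disj: "disjoint_family_on B F"
  shows "measure_pmf.prob (Pi_pmf A False (\<lambda>_. bernoulli_pmf p)) {\<omega>. \<forall>S\<in>F. \<exists>g\<in>B S. \<omega> g}
       = (\<Prod>S\<in>F. 1 - (1 - p) ^ card (B S))"
\<comment> \<open>The product rule \<open>indep_varsD\<close> requires a nonempty index set.\<close>
proof (cases "F = {}")
  case True
  then show ?thesis by simp
next
  case False
  define P where "P = Pi_pmf A False (\<lambda>_. bernoulli_pmf p)"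
  note prob_space = measure_pmf.prob_space_axioms[of P]
  have finB: "finite (B S)" if "S \<in> F" for S
    using B[OF that] \<open>finite A\<close> finite_subset by blast
  have "prob_space.indep_vars P (\<lambda>_. count_space UNIV) (\<lambda>x f. f x) A"
    unfolding P_def by (rule indep_vars_Pi_pmf) fact
  then have "prob_space.indep_vars P (\<lambda>S. PiM (B S) (\<lambda>_. count_space UNIV))
      (\<lambda>S \<omega>. restrict (\<lambda>g. \<omega> g) (B S)) F"
    by (rule prob_space.indep_vars_restrict[OF prob_space]) (use B disj in auto)
  then have ind: "prob_space.indep_vars P (\<lambda>_. count_space UNIV)
      (\<lambda>S \<omega>. \<exists>g\<in>B S. restrict (\<lambda>g. \<omega> g) (B S) g) F"
  proof (rule prob_space.indep_vars_compose2[OF prob_space])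
    fix S assume "S \<in> F"
    then have "finite (B S)" by (rule finB)
    then show "(\<lambda>f. \<exists>g\<in>B S. f g) \<in> measurable (PiM (B S) (\<lambda>_. count_space UNIV)) (count_space UNIV)"
      by measurable
  qed
  have "{\<omega>. \<forall>S\<in>F. \<exists>g\<in>B S. \<omega> g} =
      (\<Inter>S\<in>F. (\<lambda>\<omega>. \<exists>g\<in>B S. restrict (\<lambda>g. \<omega> g) (B S) g) -` {True} \<inter> space (measure_pmf P))"
    by auto
  then have "measure_pmf.prob P {\<omega>. \<forall>S\<in>F. \<exists>g\<in>B S. \<omega> g} =
      (\<Prod>S\<in>F. measure_pmf.prob P
        ((\<lambda>\<omega>. \<exists>g\<in>B S. restrict (\<lambda>g. \<omega> g) (B S) g) -` {True} \<inter> space (measure_pmf P)))"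
    using prob_space.indep_varsD[OF prob_space ind False \<open>finite F\<close> order_refl, of "\<lambda>_. {True}"] by simp
  also have "\<dots> = (\<Prod>S\<in>F. 1 - (1 - p) ^ card (B S))"
  proof (rule prod.cong[OF refl])
    fix S assume S: "S \<in> F"
    \<comment> \<open>The complement is a box: coordinates in \<open>B S\<close> are forced to be
      \<open>False\<close>, the others are free. Its probability is therefore a product over
      coordinates.\<close>
    have "(\<lambda>\<omega>. \<exists>g\<in>B S. restrict (\<lambda>g. \<omega> g) (B S) g) -` {True} \<inter> space (measure_pmf P)
        = UNIV - Pi A (\<lambda>g. if g \<in> B S then {False} else UNIV)"
      using B[OF S] by (auto simp: Pi_def split: if_splits)
    moreover have "measure_pmf.prob P (Pi A (\<lambda>g. if g \<in> B S then {False} else UNIV))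
        = (\<Prod>g\<in>A. if g \<in> B S then 1 - p else 1)"
      unfolding P_def measure_Pi_pmf_Pi[OF \<open>finite A\<close>]
      by (rule prod.cong) (use assms in \<open>auto simp: measure_pmf_single\<close>)
    moreover have "\<dots> = (1 - p) ^ card (B S)"
      using B[OF S] \<open>finite A\<close> by (simp flip: prod.inter_restrict add: Int_absorb1)
    ultimately show "measure_pmf.prob P
        ((\<lambda>\<omega>. \<exists>g\<in>B S. restrict (\<lambda>g. \<omega> g) (B S) g) -` {True} \<inter> space (measure_pmf P))
        = 1 - (1 - p) ^ card (B S)"
      using prob_space.prob_compl[OF prob_space, of "Pi A (\<lambda>g. if g \<in> B S then {False} else UNIV)"] by simp
  qed
  finally show ?thesis by (simp add: P_def)
qed

text \<open>Such a \<open>g\<close> is determined by \<open>g - U\<close>, an arbitrary subset of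
  \<open>A - U\<close> of size \<open>d - card S\<close>. For \<open>card S > d\<close> truncated
  subtraction would turn the right-hand side into 1, although no such \<open>g\<close>
  exists.\<close>

lemma card_nsets_prescribed_inter:
  assumes "finite A" "S \<subseteq> U" "U \<subseteq> A" "card S \<le> d"
  shows "card {g \<in> nsets A d. g \<inter> U = S} = (card A - card U) choose (d - card S)"
proof -
  have fin: "finite U" "finite S" "finite (A - U)"
    using assms by (auto intro: finite_subset)
  have "bij_betw (\<lambda>T. S \<union> T) (nsets (A - U) (d - card S)) {g \<in> nsets A d. g \<inter> U = S}"
  proof (rule bij_betw_byWitness[where f' = "\<lambda>g. g - U"])
    show "(\<lambda>T. S \<union> T) ` nsets (A - U) (d - card S) \<subseteq> {g \<in> nsets A d. g \<inter> U = S}"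
    proof (rule image_subsetI)
      fix T assume T: "T \<in> nsets (A - U) (d - card S)"
      then have "S \<inter> T = {}" using \<open>S \<subseteq> U\<close> by (auto simp: nsets_def)
      then have "card (S \<union> T) = d"
        using T fin \<open>card S \<le> d\<close> by (simp add: nsets_def card_Un_disjoint)
      then show "S \<union> T \<in> {g \<in> nsets A d. g \<inter> U = S}"
        using T fin assms by (auto simp: nsets_def)
    qed
    show "(\<lambda>g. g - U) ` {g \<in> nsets A d. g \<inter> U = S} \<subseteq> nsets (A - U) (d - card S)"
      by (auto simp: nsets_def card_Diff_subset_Int)
  qed (use \<open>S \<subseteq> U\<close> in \<open>auto simp: nsets_def\<close>)
  then have "card {g \<in> nsets A d. g \<inter> U = S} = card (nsets (A - U) (d - card S))"
    by (rule bij_betw_same_card[symmetric])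
  also have "\<dots> = card (A - U) choose (d - card S)"
    by simp
  finally show ?thesis
    using fin assms by (simp add: card_Diff_subset)
qed

text \<open>A potential hyperedge has only one trace on \<open>h\<close>, so the blocks
  \<open>B S\<close> are pairwise disjoint and the product formula applies to them.\<close>

lemma prob_traces:
  assumes h: "h \<in> nsets {1..n} d" and F: "F \<subseteq> Pow h" and p: "0 \<le> p" "p \<le> 1"
  shows "measure_pmf.prob (random_hypergraph n d p) {H. \<forall>S\<in>F. \<exists>g\<in>H. g \<inter> h = S}
       = (\<Prod>S\<in>F. 1 - (1 - p) ^ ((n - d) choose (d - card S)))"
proof -
  define B where "B S = {g \<in> nsets {1..n} d. g \<inter> h = S}" for S
  have h': "finite h" "card h = d" "h \<subseteq> {1..n}" using h by (auto simp: nsets_def)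
  have "measure_pmf.prob (random_hypergraph n d p) {H. \<forall>S\<in>F. \<exists>g\<in>H. g \<inter> h = S}
     = measure_pmf.prob (Pi_pmf (nsets {1..n} d) False (\<lambda>_. bernoulli_pmf p))
         {\<omega>. \<forall>S\<in>F. \<exists>g\<in>B S. \<omega> g}"
    unfolding random_hypergraph_def measure_map_pmf B_def
    by (rule arg_cong[where f = "measure_pmf.prob _"]) auto
  also have "\<dots> = (\<Prod>S\<in>F. 1 - (1 - p) ^ card (B S))"
    by (rule prob_Pi_pmf_hits)
      (use p h' finite_subset[OF F] in \<open>auto simp: B_def disjoint_family_on_def finite_imp_finite_nsets\<close>)
  also have "\<dots> = (\<Prod>S\<in>F. 1 - (1 - p) ^ ((n - d) choose (d - card S)))"
  proof (rule prod.cong[OF refl])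
    fix S assume "S \<in> F"
    then have "S \<subseteq> h" using F by auto
    then have "card S \<le> d" using h' card_mono by blast
    then show "1 - (1 - p) ^ card (B S) = 1 - (1 - p) ^ ((n - d) choose (d - card S))"
      unfolding B_def using card_nsets_prescribed_inter[of "{1..n}" S h d] \<open>S \<subseteq> h\<close> h' by simp
  qed
  finally show ?thesis .
qed

section \<open>Two-sided bounds for the probability that given pairs are covered\<close>

text \<open>It suffices that every pair in \<open>K\<close> is exactly the trace of some hyperedge.
  These events are independent with a common probability.\<close>

lemma prob_cover_ge:
  assumes h: "h \<in> nsets {1..n} d" and K: "K \<subseteq> nsets h 2" and p: "0 \<le> p" "p \<le> 1"
  shows "(1 - (1 - p) ^ ((n - d) choose (d - 2))) ^ card K
       \<le> measure_pmf.prob (random_hypergraph n d p) {H. K \<subseteq> proj_edges n H}"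
proof -
  have "(1 - (1 - p) ^ ((n - d) choose (d - 2))) ^ card K
      = (\<Prod>S\<in>K. 1 - (1 - p) ^ ((n - d) choose (d - card S)))"
    using K by (auto simp: nsets_def subset_iff simp flip: prod_constant intro!: prod.cong)
  also have "\<dots> = measure_pmf.prob (random_hypergraph n d p) {H. \<forall>S\<in>K. \<exists>g\<in>H. g \<inter> h = S}"
    by (rule prob_traces[OF h _ p, symmetric]) (use K in \<open>auto simp: nsets_def\<close>)
  also have "\<dots> \<le> measure_pmf.prob (random_hypergraph n d p) {H. K \<subseteq> proj_edges n H}"
  proof (rule measure_pmf.finite_measure_mono)
    have "e \<in> nsets {1..n} 2" if "e \<in> K" for e
      using K h that by (auto simp: nsets_def)
    then show "{H. \<forall>S\<in>K. \<exists>g\<in>H. g \<inter> h = S} \<subseteq> {H. K \<subseteq> proj_edges n H}"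
      by (auto simp: proj_edges_def)
  qed simp
  finally show ?thesis .
qed

text \<open>These are the configurations in the upper bound beyond the one where each pair is its
  own trace. No minimality is demanded, so the family of all traces of size at least 2 qualifies as
  soon as it covers \<open>K\<close> and has a member of size at least 3.\<close>

definition overlapping_covers :: "'a set \<Rightarrow> 'a set set \<Rightarrow> 'a set set set" where
  "overlapping_covers h K = {F. F \<subseteq> Pow h \<and> (\<forall>S\<in>F. 2 \<le> card S) \<and> (\<exists>S\<in>F. 3 \<le> card S)
     \<and> K \<subseteq> (\<Union>S\<in>F. nsets S 2)}"

text \<open>A union bound over the trace patterns that can cover \<open>K\<close>: either all pairs
  of \<open>K\<close> are traces, or the traces form an overlapping cover.\<close>

lemma prob_cover_le:
  assumes h: "h \<in> nsets {1..n} d" and K: "K \<subseteq> nsets h 2" and p: "0 \<le> p" "p \<le> 1"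
  shows "measure_pmf.prob (random_hypergraph n d p) {H. K \<subseteq> proj_edges n H}
       \<le> (1 - (1 - p) ^ ((n - d) choose (d - 2))) ^ card K
         + (\<Sum>F\<in>overlapping_covers h K. \<Prod>S\<in>F. 1 - (1 - p) ^ ((n - d) choose (d - card S)))"
proof -
  let ?P = "measure_pmf.prob (random_hypergraph n d p)"
  let ?T = "\<lambda>F. {H. \<forall>S\<in>F. \<exists>g\<in>H. g \<inter> h = S}"
  let ?C = "overlapping_covers h K"
  have "finite h" using h by (auto simp: nsets_def)
  then have finC: "finite ?C"
    by (auto simp: overlapping_covers_def intro: finite_subset[of _ "Pow (Pow h)"])
  have "{H. K \<subseteq> proj_edges n H} \<subseteq> ?T K \<union> (\<Union>F\<in>?C. ?T F)"
  proof
    fix H assume "H \<in> {H. K \<subseteq> proj_edges n H}"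
    then have H: "K \<subseteq> proj_edges n H" by simp
    \<comment> \<open>All traces of \<open>H\<close> with at least two elements; smaller traces
      cover no pair. If none has three elements, a trace covering \<open>e\<close> must equal
      \<open>e\<close>, hence \<open>K \<subseteq> F\<close>.\<close>
    define F where "F = {S. 2 \<le> card S \<and> (\<exists>g\<in>H. g \<inter> h = S)}"
    have cov: "\<exists>S\<in>F. e \<in> nsets S 2" if "e \<in> K" for e
    proof -
      obtain g where g: "g \<in> H" "e \<subseteq> g" using subsetD[OF H \<open>e \<in> K\<close>] by (auto simp: proj_edges_def)
      have e: "e \<subseteq> h" "finite e" "card e = 2" using K that by (auto simp: nsets_def)
      then have "2 \<le> card (g \<inter> h)"
        using card_mono[of "g \<inter> h" e] g \<open>finite h\<close> by auto
      then show ?thesis using g e by (auto simp: F_def nsets_def)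
    qed
    show "H \<in> ?T K \<union> (\<Union>F\<in>?C. ?T F)"
    proof (cases "\<exists>S\<in>F. 3 \<le> card S")
      case True
      then have "F \<in> ?C" using cov by (auto simp: overlapping_covers_def F_def)
      moreover have "H \<in> ?T F" by (auto simp: F_def)
      ultimately show ?thesis by blast
    next
      case False
      have "K \<subseteq> F"
      proof
        fix e assume "e \<in> K"
        then obtain S where S: "S \<in> F" "e \<in> nsets S 2" using cov by blast
        then have "card S = 2" using False by (force simp: F_def)
        then have "e = S" using S(2) by (intro card_subset_eq card_ge_0_finite) (auto simp: nsets_def)
        then show "e \<in> F" using S by simp
      qed
      then have "H \<in> ?T K" by (auto simp: F_def)
      then show ?thesis by blast
    qed
  qed
  then have "?P {H. K \<subseteq> proj_edges n H} \<le> ?P (?T K \<union> (\<Union>F\<in>?C. ?T F))"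
    by (intro measure_pmf.finite_measure_mono) auto
  also have "\<dots> \<le> ?P (?T K) + ?P (\<Union>F\<in>?C. ?T F)"
    by (rule measure_Un_le) auto
  also have "?P (\<Union>F\<in>?C. ?T F) \<le> (\<Sum>F\<in>?C. ?P (?T F))"
    by (rule measure_UNION_le) (use finC in auto)
  also have "(\<Sum>F\<in>?C. ?P (?T F))
      = (\<Sum>F\<in>?C. \<Prod>S\<in>F. 1 - (1 - p) ^ ((n - d) choose (d - card S)))"
    by (rule sum.cong[OF refl], rule prob_traces[OF h _ p]) (auto simp: overlapping_covers_def)
  also have "?P (?T K) = (\<Prod>S\<in>K. 1 - (1 - p) ^ ((n - d) choose (d - card S)))"
    by (rule prob_traces[OF h _ p]) (use K in \<open>auto simp: nsets_def\<close>)
  also have "\<dots> = (1 - (1 - p) ^ ((n - d) choose (d - 2))) ^ card K"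
    using K by (auto simp: nsets_def subset_iff simp flip: prod_constant intro!: prod.cong)
  finally show ?thesis by simp
qed

text \<open>A cover of \<open>K\<close> has at least \<open>card K\<close> pairs counted with
  multiplicity, so its factors contribute at least that power of \<open>a\<close>, and one large
  trace supplies the extra factor \<open>\<eta>\<close>. At most \<open>2 ^ 2 ^ d\<close> families
  occur, each with at most \<open>2 ^ d\<close> members.\<close>

lemma overlapping_covers_sum_le:
  fixes q :: "nat \<Rightarrow> real"
  assumes h: "finite h" "card h = d"
    and q: "\<And>s. 2 \<le> s \<Longrightarrow> s \<le> d \<Longrightarrow> 0 \<le> q s \<and> q s \<le> C * a ^ (s choose 2)"
    and q3: "\<And>s. 3 \<le> s \<Longrightarrow> s \<le> d \<Longrightarrow> q s \<le> C * \<eta> * a ^ (s choose 2)"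
    and a: "0 \<le> a" "a \<le> 1" and \<eta>: "0 \<le> \<eta>" and C: "1 \<le> C"
  shows "(\<Sum>F\<in>overlapping_covers h K. \<Prod>S\<in>F. q (card S))
       \<le> 2 ^ 2 ^ d * C ^ 2 ^ d * (\<eta> * a ^ card K)"
proof -
  have "(\<Prod>S\<in>F. q (card S)) \<le> C ^ 2 ^ d * (\<eta> * a ^ card K)"
    if F: "F \<in> overlapping_covers h K" for F
  proof -
    have Fh: "F \<subseteq> Pow h" and F2: "\<And>S. S \<in> F \<Longrightarrow> 2 \<le> card S"
      and KF: "K \<subseteq> (\<Union>S\<in>F. nsets S 2)"
      using F by (auto simp: overlapping_covers_def)
    obtain R where R: "R \<in> F" "3 \<le> card R" using F by (auto simp: overlapping_covers_def)
    have finF: "finite F" using Fh h finite_subset by blast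
    have finS: "finite S" "card S \<le> d" if "S \<in> F" for S
    proof -
      have "S \<subseteq> h" using Fh that by auto
      then show "finite S" "card S \<le> d"
        using h finite_subset card_mono[of h S] by auto
    qed
    have cF: "card F \<le> 2 ^ d"
      using card_mono[OF _ Fh] h by (simp add: card_Pow)
    have "card K \<le> card (\<Union>S\<in>F. nsets S 2)"
      by (rule card_mono) (use KF finF finS in \<open>auto simp: finite_imp_finite_nsets\<close>)
    also have "\<dots> \<le> (\<Sum>S\<in>F. card (nsets S 2))" by (rule card_UN_le) fact
    also have "\<dots> = (\<Sum>S\<in>F. card S choose 2)"
      by (rule sum.cong) (use finS in \<open>auto simp: card_nsets\<close>)
    finally have cK: "card K \<le> (\<Sum>S\<in>F. card S choose 2)" .
    \<comment> \<open>Only the one trace \<open>R\<close> gets the sharper bound, so exactly one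
      factor \<open>\<eta>\<close> is gained however many large traces \<open>F\<close>
      contains.\<close>
    have "(\<Prod>S\<in>F. q (card S)) = q (card R) * (\<Prod>S\<in>F - {R}. q (card S))"
      using R finF by (simp add: prod.remove)
    also have "\<dots> \<le> (C * \<eta> * a ^ (card R choose 2)) * (\<Prod>S\<in>F - {R}. C * a ^ (card S choose 2))"
      using q q3 R finS F2 a \<eta> C by (intro mult_mono prod_mono prod_nonneg) auto
    also have "\<dots> = \<eta> * (\<Prod>S\<in>F. C * a ^ (card S choose 2))"
      using R finF by (simp add: prod.remove)
    also have "\<dots> = C ^ card F * (\<eta> * a ^ (\<Sum>S\<in>F. card S choose 2))"
      by (simp add: prod.distrib power_sum)
    \<comment> \<open>\<open>C \<ge> 1\<close> permits raising its exponent, and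
      \<open>a \<le> 1\<close> permits lowering the other to \<open>card K\<close>.\<close>
    also have "\<dots> \<le> C ^ 2 ^ d * (\<eta> * a ^ card K)"
      using cF cK a \<eta> C
      by (intro mult_mono mult_left_mono power_increasing power_decreasing mult_nonneg_nonneg) auto
    finally show ?thesis .
  qed
  then have "(\<Sum>F\<in>overlapping_covers h K. \<Prod>S\<in>F. q (card S))
      \<le> real (card (overlapping_covers h K)) * (C ^ 2 ^ d * (\<eta> * a ^ card K))"
    by (rule sum_bounded_above)
  also have "\<dots> \<le> 2 ^ 2 ^ d * (C ^ 2 ^ d * (\<eta> * a ^ card K))"
  proof (rule mult_right_mono)
    have "overlapping_covers h K \<subseteq> Pow (Pow h)"
      by (auto simp: overlapping_covers_def)
    then have "card (overlapping_covers h K) \<le> card (Pow (Pow h))"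
      using h by (intro card_mono) auto
    also have "\<dots> = 2 ^ 2 ^ d"
      using h by (simp add: card_Pow)
    finally show "real (card (overlapping_covers h K)) \<le> 2 ^ 2 ^ d"
      by (metis of_nat_le_iff of_nat_numeral of_nat_power)
  qed (use a \<eta> C in simp)
  finally show ?thesis by (simp add: mult.assoc)
qed

section \<open>Linearity of expectation and elementary estimates\<close>

lemma expectation_card_Collect:
  assumes "finite A"
  shows "measure_pmf.expectation M (\<lambda>H. real (card {h \<in> A. Q h H}))
       = (\<Sum>h\<in>A. measure_pmf.prob M {H. Q h H})"
proof -
  have "real (card {h \<in> A. Q h H}) = (\<Sum>h\<in>A. indicator {H. Q h H} H)" for H
    using assms by (simp add: indicator_def sum.If_cases Int_def)
  then have "measure_pmf.expectation M (\<lambda>H. real (card {h \<in> A. Q h H}))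
      = measure_pmf.expectation M (\<lambda>H. \<Sum>h\<in>A. indicator {H. Q h H} H)"
    by simp
  also have "\<dots> = (\<Sum>h\<in>A. measure_pmf.expectation M (indicator {H. Q h H}))"
    by (rule Bochner_Integration.integral_sum) (simp add: measure_pmf.emeasure_eq_measure)
  finally show ?thesis by simp
qed

lemma one_minus_power_le:
  fixes p :: real
  assumes "0 \<le> p" "p \<le> 1"
  shows "1 - (1 - p) ^ N \<le> p * real N"
  using Bernoulli_inequality[of "- p" N] assms by (simp add: mult.commute)

text \<open>Bernoulli bounds \<open>(1 + p) ^ N\<close> from below, and \<open>(1 - p) ^ N\<close>
  times \<open>(1 + p) ^ N\<close> is at most 1. Together with the upper bound
  \<open>p * real N\<close> this determines the probability asymptotically whenever
  \<open>p * real N\<close> tends to 0.\<close>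

lemma one_minus_power_ge:
  fixes p :: real
  assumes "0 \<le> p" "p \<le> 1"
  shows "p * real N / (1 + p * real N) \<le> 1 - (1 - p) ^ N"
proof -
  have pos: "0 < 1 + p * real N" using assms by (simp add: add_pos_nonneg)
  have "(1 - p) ^ N * (1 + p * real N) \<le> (1 - p) ^ N * (1 + p) ^ N"
    using Bernoulli_inequality[of p N] assms by (intro mult_left_mono) (simp_all add: mult.commute)
  also have "\<dots> = (1 - p\<^sup>2) ^ N"
    by (simp flip: power_mult_distrib add: power2_eq_square algebra_simps)
  also have "\<dots> \<le> 1"
    using assms by (intro power_le_one) (simp_all add: power_le_one)
  finally have "(1 - p) ^ N \<le> 1 / (1 + p * real N)"
    using pos by (simp add: field_simps)
  then show ?thesis using pos by (simp add: field_simps)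
qed

lemma binomial_diff_asymptotic:
  "(\<lambda>n. real ((n - l) choose k) / real n ^ k) \<longlonglongrightarrow> 1 / fact k"
proof (rule Lim_transform_eventually)
  have "(\<lambda>n. (real n - real l - real i) / real n) \<longlonglongrightarrow> 1" for i
    by real_asymp
  then have "(\<lambda>n. (\<Prod>i<k. (real n - real l - real i) / real n) / fact k) \<longlonglongrightarrow> (\<Prod>i<k. 1) / fact k"
    by (intro tendsto_divide tendsto_prod tendsto_const) auto
  then show "(\<lambda>n. (\<Prod>i<k. (real n - real l - real i) / real n) / fact k) \<longlonglongrightarrow> 1 / fact k"
    by simp
  show "\<forall>\<^sub>F n in sequentially. (\<Prod>i<k. (real n - real l - real i) / real n) / fact k
      = real ((n - l) choose k) / real n ^ k"
    \<comment> \<open>From \<open>n \<ge> l\<close> on, the truncated difference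
      \<open>n - l\<close> agrees with the real one.\<close>
    using eventually_ge_at_top[of l]
  proof eventually_elim
    case (elim n)
    then show ?case
      by (simp add: binomial_gbinomial gbinomial_prod_rev prod_dividef of_nat_diff atLeast0LessThan)
  qed
qed

lemma binomial_diff_asymp_ratio:
  "(\<lambda>n. real ((n - l) choose k) / real (n choose k)) \<longlonglongrightarrow> 1"
proof (rule Lim_transform_eventually)
  show "(\<lambda>n. (real ((n - l) choose k) / real n ^ k) / (real ((n - 0) choose k) / real n ^ k)) \<longlonglongrightarrow> 1"
    using tendsto_divide[OF binomial_diff_asymptotic[of l k] binomial_diff_asymptotic[of 0 k]] by simp
  show "\<forall>\<^sub>F n in sequentially. (real ((n - l) choose k) / real n ^ k) / (real ((n - 0) choose k) / real n ^ k)
      = real ((n - l) choose k) / real (n choose k)"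
    using eventually_gt_at_top[of 0] by eventually_elim simp
qed

section \<open>Bounds on the expectation for fixed \<open>n\<close>\<close>

text \<open>Every admissible \<open>h\<close> satisfies the same covering bounds, so linearity
  multiplies them by the number of such \<open>h\<close>. The quantities \<open>a\<close> and
  \<open>\<eta>\<close> stay abstract, which confines the asymptotics to the hypotheses on
  \<open>q\<close>.\<close>

lemma expectation_rooted_cliques_bounds:
  fixes C a \<eta> p :: real
  defines "q \<equiv> \<lambda>n d p s. 1 - (1 - p :: real) ^ ((n - d) choose (d - s))"
  assumes "l \<le> n" "m \<le> l" "m \<le> d" and p: "0 \<le> p" "p \<le> 1"
    and q: "\<And>s. 2 \<le> s \<Longrightarrow> s \<le> d \<Longrightarrow> q n d p s \<le> C * a ^ (s choose 2)"
    and q3: "\<And>s. 3 \<le> s \<Longrightarrow> s \<le> d \<Longrightarrow> q n d p s \<le> C * \<eta> * a ^ (s choose 2)"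
    and a: "0 \<le> a" "a \<le> 1" and \<eta>: "0 \<le> \<eta>" and C: "1 \<le> C"
  defines "E \<equiv> measure_pmf.expectation (random_hypergraph n d p)
                (\<lambda>H. real (card (rooted_cliques n d m l (proj_edges n H))))"
    and "k \<equiv> (d choose 2) - (m choose 2)"
  shows "real ((n - l) choose (d - m)) * q n d p 2 ^ k \<le> E"
    and "E \<le> real ((n - l) choose (d - m)) * (q n d p 2 ^ k + 2 ^ 2 ^ d * C ^ 2 ^ d * (\<eta> * a ^ k))"
proof -
  define Hs where "Hs = {h \<in> nsets {1..n} d. h \<inter> {1..l} = {1..m}}"
  define K where "K h = nsets h 2 - nsets {1..m} 2" for h :: "nat set"
  let ?P = "\<lambda>h. measure_pmf.prob (random_hypergraph n d p) {H. K h \<subseteq> proj_edges n H}"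
  have finHs: "finite Hs" by (simp add: Hs_def finite_imp_finite_nsets)
  have cardHs: "card Hs = (n - l) choose (d - m)"
    unfolding Hs_def using card_nsets_prescribed_inter[of "{1..n}" "{1..m}" "{1..l}" d] assms by simp
  have "rooted_cliques n d m l G = {h \<in> Hs. K h \<subseteq> G}" for G
    by (auto simp: rooted_cliques_def Hs_def K_def)
  then have E: "E = (\<Sum>h\<in>Hs. ?P h)"
    unfolding E_def using finHs by (simp add: expectation_card_Collect)
  have bounds: "q n d p 2 ^ k \<le> ?P h"
    "?P h \<le> q n d p 2 ^ k + 2 ^ 2 ^ d * C ^ 2 ^ d * (\<eta> * a ^ k)" if "h \<in> Hs" for h
  proof -
    have h: "h \<in> nsets {1..n} d" "{1..m} \<subseteq> h" using that by (auto simp: Hs_def)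
    then have h': "finite h" "card h = d" by (auto simp: nsets_def)
    have K: "K h \<subseteq> nsets h 2" by (auto simp: K_def)
    \<comment> \<open>The exemption removes exactly \<open>m choose 2\<close> pairs because
      \<open>{1..m} \<subseteq> h\<close>.\<close>
    have "card (K h) = card (nsets h 2) - card (nsets {1..m} 2)"
      unfolding K_def
      by (rule card_Diff_subset) (use h(2) in \<open>simp_all add: finite_imp_finite_nsets nsets_mono\<close>)
    then have cK: "card (K h) = k" using h' by (simp add: k_def)
    show "q n d p 2 ^ k \<le> ?P h"
      using prob_cover_ge[OF h(1) K p] by (simp add: q_def cK)
    have "?P h \<le> q n d p 2 ^ k + (\<Sum>F\<in>overlapping_covers h (K h). \<Prod>S\<in>F. q n d p (card S))"
      using prob_cover_le[OF h(1) K p] by (simp add: q_def cK)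
    also have "(\<Sum>F\<in>overlapping_covers h (K h). \<Prod>S\<in>F. q n d p (card S))
        \<le> 2 ^ 2 ^ d * C ^ 2 ^ d * (\<eta> * a ^ card (K h))"
    proof (rule overlapping_covers_sum_le[OF h' _ q3 a \<eta> C])
      fix s assume "2 \<le> s" "s \<le> d"
      then show "0 \<le> q n d p s \<and> q n d p s \<le> C * a ^ (s choose 2)"
        using q p by (simp add: q_def power_le_one)
    qed
    finally show "?P h \<le> q n d p 2 ^ k + 2 ^ 2 ^ d * C ^ 2 ^ d * (\<eta> * a ^ k)"
      by (simp add: cK)
  qed
  show "real ((n - l) choose (d - m)) * q n d p 2 ^ k \<le> E"
    unfolding E using sum_bounded_below[of Hs "q n d p 2 ^ k" ?P] bounds(1) cardHs by simp
  show "E \<le> real ((n - l) choose (d - m)) * (q n d p 2 ^ k + 2 ^ 2 ^ d * C ^ 2 ^ d * (\<eta> * a ^ k))"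
    unfolding E using sum_bounded_above[OF bounds(2), of Hs] cardHs by simp
qed

section \<open>Comparison of exponents and passage to the limit\<close>

text \<open>With \<open>u = 1 - \<delta>\<close>, the gap between the exponents for separate pairs
  and for one large trace is \<open>(s - 2) * (1 - u * (s + 1) / 2)\<close>. Since
  \<open>s - 2 \<ge> 1\<close> and \<open>s \<le> d\<close>, it is at least the value
  \<open>1 - u * (d + 1) / 2\<close>, whose positivity is the lower bound on
  \<open>\<delta>\<close>.\<close>

lemma trace_exponent_le:
  fixes d s :: nat and \<delta> :: real
  assumes "3 \<le> s" "s \<le> d" and \<delta>: "(real d - 1) / (real d + 1) < \<delta>" "\<delta> < 1"
  shows "1 + \<delta> - real s \<le> - (1 - (1 - \<delta>) * (real d + 1) / 2) + (\<delta> - 1) * real (s choose 2)"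
proof -
  have choose: "real (s choose 2) = real s * (real s - 1) / 2"
    using assms by (simp add: choose_two real_of_nat_div of_nat_diff)
  define u where "u = 1 - \<delta>"
  have u: "0 < u" "u * (real d + 1) < 2"
    using \<delta> by (auto simp: u_def field_simps)
  have "u * (real s + 1) \<le> u * (real d + 1)"
    using u assms by (intro mult_left_mono) auto
  then have "1 * (1 - u * (real d + 1) / 2) \<le> (real s - 2) * (1 - u * (real s + 1) / 2)"
    using assms u by (intro mult_mono) auto
  then show ?thesis
    unfolding choose by (simp add: u_def field_simps)
qed

theorem theorem26:
  fixes d m l :: nat and c \<delta> :: real and p :: "nat \<Rightarrow> real"
  assumes "d \<ge> 3" and "c > 0"
    and "(real d - 1) / (real d + 1) < \<delta>" and "\<delta> < 1"
    and "m \<le> d - 1" and "m \<le> l"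
    and "\<And>n. 0 \<le> p n" and "\<And>n. p n \<le> 1"
    and "(\<lambda>n. p n / real n powr (- real d + 1 + \<delta>)) \<longlonglongrightarrow> c"
  shows "(\<lambda>n. measure_pmf.expectation (random_hypergraph n d (p n))
                (\<lambda>H. real (card (rooted_cliques n d m l (proj_edges n H)))))
         \<sim>[sequentially]
         (\<lambda>n. real (n choose (d - m)) *
                (c * real n powr (\<delta> - 1) / fact (d - 2)) ^ ((d choose 2) - (m choose 2)))"
proof -
  define k where "k = (d choose 2) - (m choose 2)"
  define E where "E n = measure_pmf.expectation (random_hypergraph n d (p n))
    (\<lambda>H. real (card (rooted_cliques n d m l (proj_edges n H))))" for n
  define a where "a n = real n powr (\<delta> - 1)" for n
  define b where "b n = c * a n / fact (d - 2)" for n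
  define \<epsilon> where "\<epsilon> = 1 - (1 - \<delta>) * (real d + 1) / 2"
  define \<eta> where "\<eta> n = real n powr (- \<epsilon>)" for n
  define q where "q n s = 1 - (1 - p n) ^ ((n - d) choose (d - s))" for n s
  \<comment> \<open>The expected number of hyperedges whose trace on \<open>h\<close> is a given
    pair; it is the first-order approximation to \<open>q n 2\<close>, and \<open>b n\<close> is its
    asymptotic value.\<close>
  define x where "x n = p n * real ((n - d) choose (d - 2))" for n
  \<comment> \<open>The constant of \<open>overlapping_covers_sum_le\<close> with
    \<open>C = c + 1\<close>, times the factor that converts \<open>a n ^ k\<close> into
    \<open>b n ^ k\<close>.\<close>
  define D where "D = 2 ^ 2 ^ d * (c + 1) ^ 2 ^ d * (fact (d - 2) / c) ^ k"
  define N where "N n = real ((n - l) choose (d - m)) / real (n choose (d - m))" for n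

  have \<epsilon>: "0 < \<epsilon>"
    using assms(3,4) by (simp add: \<epsilon>_def field_simps)
  have pos: "eventually (\<lambda>n::nat. 0 < n) sequentially"
    by (rule eventually_gt_at_top)
  have \<eta>_lim: "\<eta> \<longlonglongrightarrow> 0"
    unfolding \<eta>_def using \<epsilon> by real_asymp
  have b_lim: "b \<longlonglongrightarrow> 0"
    unfolding b_def a_def using assms(4) by real_asymp
  have N_lim: "N \<longlonglongrightarrow> 1"
    unfolding N_def by (rule binomial_diff_asymp_ratio)

  have x_b: "(\<lambda>n. x n / b n) \<longlonglongrightarrow> 1"
  proof (rule Lim_transform_eventually)
    have "(\<lambda>n. (p n / real n powr (- real d + 1 + \<delta>))
        * (real ((n - d) choose (d - 2)) / real n ^ (d - 2)) * (fact (d - 2) / c))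
        \<longlonglongrightarrow> c * (1 / fact (d - 2)) * (fact (d - 2) / c)"
      by (intro tendsto_mult tendsto_const assms(9) binomial_diff_asymptotic)
    then show "(\<lambda>n. (p n / real n powr (- real d + 1 + \<delta>))
        * (real ((n - d) choose (d - 2)) / real n ^ (d - 2)) * (fact (d - 2) / c)) \<longlonglongrightarrow> 1"
      using assms(2) by simp
    show "\<forall>\<^sub>F n in sequentially. (p n / real n powr (- real d + 1 + \<delta>))
        * (real ((n - d) choose (d - 2)) / real n ^ (d - 2)) * (fact (d - 2) / c) = x n / b n"
      using pos
    proof eventually_elim
      case (elim n)
      \<comment> \<open>The exponents add up to \<open>\<delta> - 1\<close>.\<close>
      have "real n powr (- real d + 1 + \<delta>) * real n ^ (d - 2) = a n"
        using elim assms(1) by (simp add: a_def flip: powr_realpow powr_add)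
      then show ?case
        using elim by (simp add: x_def b_def field_simps)
    qed
  qed
  have b_pos: "eventually (\<lambda>n. 0 < b n) sequentially"
    using pos by eventually_elim (use assms(2) in \<open>simp add: b_def a_def\<close>)
  have x_nonneg: "0 \<le> x n" for n
    using assms(7) by (simp add: x_def)
  have x_lim: "x \<longlonglongrightarrow> 0"
  proof (rule Lim_transform_eventually)
    show "(\<lambda>n. x n / b n * b n) \<longlonglongrightarrow> 0"
      using tendsto_mult[OF x_b b_lim] by simp
    show "\<forall>\<^sub>F n in sequentially. x n / b n * b n = x n"
      using b_pos by eventually_elim simp
  qed
  \<comment> \<open>\<open>q n 2\<close> lies between \<open>x n / (1 + x n)\<close> and
    \<open>x n\<close>, and \<open>x n\<close> tends to 0.\<close>
  have q_b: "(\<lambda>n. q n 2 / b n) \<longlonglongrightarrow> 1"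
  proof (rule real_tendsto_sandwich[OF _ _ _ x_b])
    show "\<forall>\<^sub>F n in sequentially. x n / b n / (1 + x n) \<le> q n 2 / b n"
      using b_pos
    proof eventually_elim
      case (elim n)
      then show ?case
        using divide_right_mono[OF one_minus_power_ge[OF assms(7,8)[of n]], of "b n" "(n - d) choose (d - 2)"]
        by (simp add: x_def q_def mult.commute)
    qed
    show "\<forall>\<^sub>F n in sequentially. q n 2 / b n \<le> x n / b n"
      using b_pos
    proof eventually_elim
      case (elim n)
      then show ?case
        using one_minus_power_le[OF assms(7,8)] by (simp add: x_def q_def divide_right_mono)
    qed
    show "(\<lambda>n. x n / b n / (1 + x n)) \<longlonglongrightarrow> 1"
      using tendsto_divide[OF x_b tendsto_add[OF tendsto_const[of 1] x_lim]] by simp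
  qed

  \<comment> \<open>The constant \<open>c + 1\<close> exceeds the limit \<open>c\<close> and is at
    least 1, as required of \<open>C\<close>.\<close>
  have "eventually (\<lambda>n. p n / real n powr (- real d + 1 + \<delta>) < c + 1) sequentially"
    using assms(9) by (rule order_tendstoD) simp
  then have q_le: "eventually (\<lambda>n. \<forall>s. 2 \<le> s \<and> s \<le> d \<longrightarrow>
      q n s \<le> (c + 1) * real n powr (1 + \<delta> - real s)) sequentially"
    using pos
  proof eventually_elim
    case (elim n)
    have "q n s \<le> (c + 1) * real n powr (1 + \<delta> - real s)" if "s \<le> d" for s
    proof -
      have "((n - d) choose (d - s)) * 1 \<le> ((n - d) choose (d - s)) * fact (d - s)"
        by (intro mult_left_mono fact_ge_1) simp
      also have "\<dots> \<le> (n - d) ^ (d - s)"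
        by (rule binomial_fact_pow)
      also have "\<dots> \<le> n ^ (d - s)"
        by (rule power_mono) auto
      finally have "(n - d) choose (d - s) \<le> n ^ (d - s)"
        by simp
      then have "real ((n - d) choose (d - s)) \<le> real n ^ (d - s)"
        by (metis of_nat_le_iff of_nat_power)
      moreover have "p n \<le> (c + 1) * real n powr (- real d + 1 + \<delta>)"
        using elim by (simp add: field_simps)
      ultimately have "p n * real ((n - d) choose (d - s))
          \<le> (c + 1) * real n powr (- real d + 1 + \<delta>) * real n ^ (d - s)"
        using assms(2,7) by (intro mult_mono) auto
      also have "\<dots> = (c + 1) * real n powr (1 + \<delta> - real s)"
        using elim that by (simp add: of_nat_diff add_diff_eq flip: powr_realpow powr_add)
      finally show ?thesis
        using one_minus_power_le[OF assms(7,8)[of n], of "(n - d) choose (d - s)"]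
        by (simp add: q_def)
    qed
    then show ?case by blast
  qed

  have bounds: "eventually (\<lambda>n. real ((n - l) choose (d - m)) * q n 2 ^ k \<le> E n \<and>
      E n \<le> real ((n - l) choose (d - m))
        * (q n 2 ^ k + 2 ^ 2 ^ d * (c + 1) ^ 2 ^ d * (\<eta> n * a n ^ k))) sequentially"
    using q_le pos eventually_ge_at_top[of l]
  proof eventually_elim
    case (elim n)
    have md: "m \<le> d" using assms(5) by simp
    have n1: "1 \<le> real n" using elim by simp
    have a_pow: "a n ^ j = real n powr ((\<delta> - 1) * real j)" for j
      using elim by (simp add: a_def powr_powr flip: powr_realpow)
    have q_le: "q n s \<le> (c + 1) * real n powr (1 + \<delta> - real s)" if "2 \<le> s" "s \<le> d" for s
      using elim that by blast
    have 3: "q n s \<le> (c + 1) * \<eta> n * a n ^ (s choose 2)" if "3 \<le> s" "s \<le> d" for s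
    proof -
      have "real n powr (1 + \<delta> - real s) \<le> real n powr (- \<epsilon> + (\<delta> - 1) * real (s choose 2))"
        using trace_exponent_le[OF that assms(3,4)] n1 by (intro powr_mono) (auto simp: \<epsilon>_def)
      also have "\<dots> = \<eta> n * a n ^ (s choose 2)"
        by (simp only: \<eta>_def a_pow powr_add)
      finally have "(c + 1) * real n powr (1 + \<delta> - real s) \<le> (c + 1) * (\<eta> n * a n ^ (s choose 2))"
        using assms(2) by (intro mult_left_mono) auto
      then show ?thesis using q_le[of s] that by (simp add: mult.assoc)
    qed
    have \<eta>1: "\<eta> n \<le> 1"
      using powr_mono[of "- \<epsilon>" 0 "real n"] \<epsilon> n1 by (simp add: \<eta>_def)
    \<comment> \<open>For \<open>s = 2\<close> the crude bound already has the exponent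
      \<open>\<delta> - 1\<close>; for larger \<open>s\<close> the sharper bound is weakened by
      \<open>\<eta> n \<le> 1\<close>.\<close>
    have 2: "q n s \<le> (c + 1) * a n ^ (s choose 2)" if "2 \<le> s" "s \<le> d" for s
    proof (cases "s = 2")
      case True
      then show ?thesis using q_le[of 2] that by (simp add: a_def)
    next
      case False
      then have "q n s \<le> (c + 1) * \<eta> n * a n ^ (s choose 2)"
        using 3 that by simp
      also have "\<dots> \<le> (c + 1) * 1 * a n ^ (s choose 2)"
        using \<eta>1 assms(2) by (intro mult_mono) (auto simp: a_def \<eta>_def)
      finally show ?thesis by simp
    qed
    have "a n \<le> 1"
      using powr_mono[of "\<delta> - 1" 0 "real n"] assms(4) n1 by (simp add: a_def)
    then show ?case
      using expectation_rooted_cliques_bounds[OF \<open>l \<le> n\<close> assms(6) md assms(7,8)[of n],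
          of "c + 1" "a n" "\<eta> n"] 2 3 assms(2)
      by (simp add: q_def E_def k_def a_def \<eta>_def)
  qed

  \<comment> \<open>After division by the claimed value, \<open>N n\<close> accounts for choosing
    from \<open>n - l\<close> rather than \<open>n\<close> vertices, and all overlapping covers
    together contribute at most \<open>N n * D * \<eta> n\<close>, which tends to 0.\<close>
  have "(\<lambda>n. E n / (real (n choose (d - m)) * b n ^ k)) \<longlonglongrightarrow> 1"
  proof (rule real_tendsto_sandwich)
    show "(\<lambda>n. N n * (q n 2 / b n) ^ k) \<longlonglongrightarrow> 1"
      using tendsto_mult[OF N_lim tendsto_power[OF q_b, of k]] by simp
    show "(\<lambda>n. N n * ((q n 2 / b n) ^ k + D * \<eta> n)) \<longlonglongrightarrow> 1"
      using tendsto_mult[OF N_lim tendsto_add[OF tendsto_power[OF q_b, of k]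
            tendsto_mult[OF tendsto_const[of D] \<eta>_lim]]] by simp
    have binom_pos: "eventually (\<lambda>n. 0 < real (n choose (d - m))) sequentially"
      using eventually_ge_at_top[of "d - m"] by eventually_elim simp
    show "\<forall>\<^sub>F n in sequentially. N n * (q n 2 / b n) ^ k \<le> E n / (real (n choose (d - m)) * b n ^ k)"
      using bounds b_pos binom_pos
    proof eventually_elim
      case (elim n)
      have "N n * (q n 2 / b n) ^ k
          = real ((n - l) choose (d - m)) * q n 2 ^ k / (real (n choose (d - m)) * b n ^ k)"
        by (simp add: N_def power_divide)
      also have "\<dots> \<le> E n / (real (n choose (d - m)) * b n ^ k)"
        using elim by (intro divide_right_mono) auto
      finally show ?case .
    qed
    show "\<forall>\<^sub>F n in sequentially. E n / (real (n choose (d - m)) * b n ^ k)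
        \<le> N n * ((q n 2 / b n) ^ k + D * \<eta> n)"
      using bounds b_pos binom_pos
    proof eventually_elim
      case (elim n)
      have "a n = fact (d - 2) / c * b n"
        using assms(2) by (simp add: b_def)
      then have a: "a n ^ k = (fact (d - 2) / c) ^ k * b n ^ k"
        by (simp only: power_mult_distrib)
      have "E n / (real (n choose (d - m)) * b n ^ k) \<le> real ((n - l) choose (d - m))
        * (q n 2 ^ k + 2 ^ 2 ^ d * (c + 1) ^ 2 ^ d * (\<eta> n * a n ^ k)) / (real (n choose (d - m)) * b n ^ k)"
        using elim by (intro divide_right_mono) auto
      also have "\<dots> = N n * ((q n 2 ^ k + D * \<eta> n * b n ^ k) / b n ^ k)"
        unfolding N_def D_def a times_divide_times_eq by (simp only: mult_ac)
      also have "\<dots> = N n * ((q n 2 / b n) ^ k + D * \<eta> n)"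
        using elim by (simp add: power_divide add_divide_distrib)
      finally show ?case .
    qed
  qed
  then show ?thesis
    unfolding E_def b_def a_def k_def by (rule asymp_equivI')
qed

end
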